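(* Let $M$ be a module over a ring $R$ in which perspectivity is transitive, i.e., for all direct summands $A,B,C$ of $M$, $A\sim_p B$ and $B\sim_p C$ imply $A\sim_p C$. Then $M$ has the perspective-Schröder-Bernstein (PSB) property.
   Context: Rings are associative with unity and modules are unital. Write $A\subseteq^{\oplus}M$ if $A$ is a direct summand of $M$. Two direct summands $A,B$ of $M$ are perspective, written $A\sim_p B$, if they have a common complement, i.e., there is a submodule $C$ of $M$ with $M=A\oplus C=B\oplus C$. A module $M$ has the PSB-property if for any direct summands $A,B$ of $M$: whenever $A\sim_p B'$ for some $B'\subseteq^{\oplus}B$ and $B\sim_p A'$ for some $A'\subseteq^{\oplus}A$ (perspectivity taken in $M$), then $A\sim_p B$. *)

theory Defs
  imports "HOL-Algebra.Algebra"
begin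

(* The library locale module requires a commutative scalar ring.  The locale below has the same
   axioms over an arbitrary ring (associative with unity). *)
locale left_module = R?: ring R + M?: abelian_group M
  for R :: "('r, 'c) ring_scheme" (structure) and M :: "('r, 'm, 'd) module_scheme" (structure) +
  assumes smult_closed [simp, intro]:
      "\<lbrakk>a \<in> carrier R; x \<in> carrier M\<rbrakk> \<Longrightarrow> a \<odot>\<^bsub>M\<^esub> x \<in> carrier M"
    and smult_l_distr:
      "\<lbrakk>a \<in> carrier R; b \<in> carrier R; x \<in> carrier M\<rbrakk> \<Longrightarrow>
        (a \<oplus>\<^bsub>R\<^esub> b) \<odot>\<^bsub>M\<^esub> x = a \<odot>\<^bsub>M\<^esub> x \<oplus>\<^bsub>M\<^esub> b \<odot>\<^bsub>M\<^esub> x"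
    and smult_r_distr:
      "\<lbrakk>a \<in> carrier R; x \<in> carrier M; y \<in> carrier M\<rbrakk> \<Longrightarrow>
        a \<odot>\<^bsub>M\<^esub> (x \<oplus>\<^bsub>M\<^esub> y) = a \<odot>\<^bsub>M\<^esub> x \<oplus>\<^bsub>M\<^esub> a \<odot>\<^bsub>M\<^esub> y"
    and smult_assoc1:
      "\<lbrakk>a \<in> carrier R; b \<in> carrier R; x \<in> carrier M\<rbrakk> \<Longrightarrow>
        (a \<otimes>\<^bsub>R\<^esub> b) \<odot>\<^bsub>M\<^esub> x = a \<odot>\<^bsub>M\<^esub> (b \<odot>\<^bsub>M\<^esub> x)"
    and smult_one [simp]:
      "x \<in> carrier M \<Longrightarrow> \<one>\<^bsub>R\<^esub> \<odot>\<^bsub>M\<^esub> x = x"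

lemma left_module_iff_module:
  assumes "cring R"
  shows "left_module R M \<longleftrightarrow> module R M"
  using assms cring.axioms(1)[OF assms]
  unfolding left_module_def module_def left_module_axioms_def module_axioms_def by auto

definition internal_direct_sum ::
  "('r, 'c) ring_scheme \<Rightarrow> ('r, 'm, 'd) module_scheme \<Rightarrow> 'm set \<Rightarrow> 'm set \<Rightarrow> bool" where
  "internal_direct_sum R M A C \<longleftrightarrow>
     submodule A R M \<and> submodule C R M \<and>
     A <+>\<^bsub>M\<^esub> C = carrier M \<and> A \<inter> C = {\<zero>\<^bsub>M\<^esub>}"

definition direct_summand ::
  "('r, 'c) ring_scheme \<Rightarrow> ('r, 'm, 'd) module_scheme \<Rightarrow> 'm set \<Rightarrow> bool" where
  "direct_summand R M A \<longleftrightarrow> (\<exists>C. internal_direct_sum R M A C)"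

definition perspective ::
  "('r, 'c) ring_scheme \<Rightarrow> ('r, 'm, 'd) module_scheme \<Rightarrow> 'm set \<Rightarrow> 'm set \<Rightarrow> bool" where
  "perspective R M A B \<longleftrightarrow>
     (\<exists>C. internal_direct_sum R M A C \<and> internal_direct_sum R M B C)"

definition perspectivity_transitive ::
  "('r, 'c) ring_scheme \<Rightarrow> ('r, 'm, 'd) module_scheme \<Rightarrow> bool" where
  "perspectivity_transitive R M \<longleftrightarrow>
     (\<forall>A B C. direct_summand R M A \<longrightarrow> direct_summand R M B \<longrightarrow> direct_summand R M C \<longrightarrow>
        perspective R M A B \<longrightarrow> perspective R M B C \<longrightarrow> perspective R M A C)"

(* B' and A' are direct summands of the modules B and A, i.e. of M with its carrier restricted,
   whereas all perspectivities are taken in M. *)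
definition PSB_property ::
  "('r, 'c) ring_scheme \<Rightarrow> ('r, 'm, 'd) module_scheme \<Rightarrow> bool" where
  "PSB_property R M \<longleftrightarrow>
     (\<forall>A B. direct_summand R M A \<longrightarrow> direct_summand R M B \<longrightarrow>
        (\<exists>B'. direct_summand R (M\<lparr>carrier := B\<rparr>) B' \<and> perspective R M A B') \<longrightarrow>
        (\<exists>A'. direct_summand R (M\<lparr>carrier := A\<rparr>) A' \<and> perspective R M B A') \<longrightarrow>
        perspective R M A B)"

end

theory Submission
  imports Defs
begin

(* If M = B \<oplus> C = A' \<oplus> C, the projection along C maps a summand B' of B onto the submodule
   A'' = A' \<inter> (B' + C) of A', and for any B'' with B = B' \<oplus> B'' the submodule B'' + C is a common
   complement of B' and A''.  Hence A is perspective to B' and B' to A'', so A is perspective to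
   A'' by transitivity.  As A'' \<subseteq> A' \<subseteq> A, the modular law forces A'' = A, so A' = A. *)

context left_module
begin

lemma submodule_Int:
  assumes "submodule H R M" "submodule K R M"
  shows "submodule (H \<inter> K) R M"
  using assms M.add.subgroups_Inter_pair
  unfolding submodule_def submodule_axioms_def by auto

lemma submodule_set_add:
  assumes H: "submodule H R M" and K: "submodule K R M"
  shows "submodule (H <+>\<^bsub>M\<^esub> K) R M"
proof (rule submodule.intro)
  show "subgroup (H <+>\<^bsub>M\<^esub> K) (add_monoid M)"
    using M.add.mult_subgroups H K unfolding submodule_def set_add_def by blast
  have car: "H \<subseteq> carrier M" "K \<subseteq> carrier M"
    using H K subgroup.subset unfolding submodule_def by fastforce+
  show "submodule_axioms (H <+>\<^bsub>M\<^esub> K) R M"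
  proof
    fix a x assume a: "a \<in> carrier R" and "x \<in> H <+>\<^bsub>M\<^esub> K"
    then obtain y z where yz: "y \<in> H" "z \<in> K" "x = y \<oplus>\<^bsub>M\<^esub> z"
      unfolding set_add_def' by blast
    then have "a \<odot>\<^bsub>M\<^esub> x = a \<odot>\<^bsub>M\<^esub> y \<oplus>\<^bsub>M\<^esub> a \<odot>\<^bsub>M\<^esub> z"
      using a car smult_r_distr by blast
    moreover have "a \<odot>\<^bsub>M\<^esub> y \<in> H" "a \<odot>\<^bsub>M\<^esub> z \<in> K"
      using a yz H K by (simp_all add: submodule.smult_closed)
    ultimately show "a \<odot>\<^bsub>M\<^esub> x \<in> H <+>\<^bsub>M\<^esub> K"
      unfolding set_add_def' by blast
  qed
qed

lemma submodule_subset: "submodule H R M \<Longrightarrow> H \<subseteq> carrier M"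
  using subgroup.subset unfolding submodule_def by fastforce

lemma submodule_zero: "submodule H R M \<Longrightarrow> \<zero>\<^bsub>M\<^esub> \<in> H"
  using subgroup.one_closed unfolding submodule_def by fastforce

lemma submodule_add:
  "\<lbrakk>submodule H R M; x \<in> H; y \<in> H\<rbrakk> \<Longrightarrow> x \<oplus>\<^bsub>M\<^esub> y \<in> H"
  using subgroup.m_closed unfolding submodule_def by fastforce

lemma submodule_neg: "\<lbrakk>submodule H R M; x \<in> H\<rbrakk> \<Longrightarrow> \<ominus>\<^bsub>M\<^esub> x \<in> H"
  using subgroup.m_inv_closed unfolding submodule_def a_inv_def by fastforce

lemma submodule_add_cancel_left:
  assumes H: "submodule H R M" and x: "x \<in> H" and y: "y \<in> carrier M"
    and xy: "x \<oplus>\<^bsub>M\<^esub> y \<in> H"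
  shows "y \<in> H"
proof -
  have "y = \<ominus>\<^bsub>M\<^esub> x \<oplus>\<^bsub>M\<^esub> (x \<oplus>\<^bsub>M\<^esub> y)"
    using M.r_neg1 submodule_subset[OF H] x y by auto
  then show ?thesis
    using submodule_add[OF H submodule_neg[OF H x] xy] by simp
qed

text \<open>Shrinking the carrier to \<open>B\<close> leaves the operations of \<open>M\<close>
  untouched. This lets the summands B' of B and A' of A be handled as submodules of \<open>M\<close>
  that lie in B and A.\<close>

lemma submodule_restrict_iff:
  assumes "submodule B R M"
  shows "submodule H R (M\<lparr>carrier := B\<rparr>) \<longleftrightarrow> submodule H R M \<and> H \<subseteq> B"
proof
  assume H: "submodule H R (M\<lparr>carrier := B\<rparr>)"
  then have sub: "subgroup H ((add_monoid M)\<lparr>carrier := B\<rparr>)"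
    unfolding submodule_def by simp
  then have "subgroup H (add_monoid M)"
    using M.add.incl_subgroup assms unfolding submodule_def by blast
  then show "submodule H R M \<and> H \<subseteq> B"
    using H subgroup.subset[OF sub] unfolding submodule_def submodule_axioms_def by simp
next
  assume H: "submodule H R M \<and> H \<subseteq> B"
  then have "subgroup H ((add_monoid M)\<lparr>carrier := B\<rparr>)"
    using M.add.subgroup_incl assms unfolding submodule_def by blast
  then show "submodule H R (M\<lparr>carrier := B\<rparr>)"
    using H unfolding submodule_def submodule_axioms_def by simp
qed

text \<open>Dedekind's modular law: if x + y lies in \<open>L\<close> with x in H \<subseteq> L,
  then y = -x + (x + y) lies in \<open>L\<close> as well.\<close>

lemma set_add_modular:
  assumes L: "submodule L R M" and HL: "H \<subseteq> L" and K: "K \<subseteq> carrier M"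
  shows "L \<inter> (H <+>\<^bsub>M\<^esub> K) = H <+>\<^bsub>M\<^esub> (L \<inter> K)"
proof
  show "L \<inter> (H <+>\<^bsub>M\<^esub> K) \<subseteq> H <+>\<^bsub>M\<^esub> (L \<inter> K)"
  proof
    fix z assume "z \<in> L \<inter> (H <+>\<^bsub>M\<^esub> K)"
    then obtain x y where xy: "x \<in> H" "y \<in> K" "z = x \<oplus>\<^bsub>M\<^esub> y" "z \<in> L"
      unfolding set_add_def' by blast
    then have "y \<in> L"
      using submodule_add_cancel_left[OF L, of x y] HL K by blast
    then show "z \<in> H <+>\<^bsub>M\<^esub> (L \<inter> K)"
      using xy unfolding set_add_def' by blast
  qed
  show "H <+>\<^bsub>M\<^esub> (L \<inter> K) \<subseteq> L \<inter> (H <+>\<^bsub>M\<^esub> K)"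
    using HL submodule_add[OF L] unfolding set_add_def' by blast
qed

lemma set_add_assoc:
  assumes "H \<subseteq> carrier M" "K \<subseteq> carrier M" "L \<subseteq> carrier M"
  shows "(H <+>\<^bsub>M\<^esub> K) <+>\<^bsub>M\<^esub> L = H <+>\<^bsub>M\<^esub> (K <+>\<^bsub>M\<^esub> L)"
  using M.add.set_mult_assoc assms unfolding set_add_def by simp

lemma set_add_commute:
  assumes "H \<subseteq> carrier M" "K \<subseteq> carrier M"
  shows "H <+>\<^bsub>M\<^esub> K = K <+>\<^bsub>M\<^esub> H"
proof -
  have "h \<oplus>\<^bsub>M\<^esub> k = k \<oplus>\<^bsub>M\<^esub> h" if "h \<in> H" "k \<in> K" for h k
    using that assms M.a_comm by blast
  then show ?thesis
    unfolding set_add_def' by fastforce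
qed

lemma set_add_zero:
  assumes "H \<subseteq> carrier M"
  shows "H <+>\<^bsub>M\<^esub> {\<zero>\<^bsub>M\<^esub>} = H"
  using assms M.r_zero unfolding set_add_def' by force

lemma subset_set_add_right:
  assumes "submodule H R M" "K \<subseteq> carrier M"
  shows "K \<subseteq> H <+>\<^bsub>M\<^esub> K"
proof
  fix k assume "k \<in> K"
  then have "k = \<zero>\<^bsub>M\<^esub> \<oplus>\<^bsub>M\<^esub> k" using assms(2) M.l_zero by auto
  then show "k \<in> H <+>\<^bsub>M\<^esub> K"
    using submodule_zero[OF assms(1)] \<open>k \<in> K\<close> unfolding set_add_def' by blast
qed

text \<open>By the modular law, K = K \<inter> (H + C) = H + (K \<inter> C) = H + 0, so nested
  submodules with a common complement coincide.\<close>

lemma internal_direct_sum_mono_eq: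
  assumes H: "internal_direct_sum R M H C" and K: "internal_direct_sum R M K C" and "H \<subseteq> K"
  shows "H = K"
proof -
  have "K \<inter> (H <+>\<^bsub>M\<^esub> C) = H <+>\<^bsub>M\<^esub> (K \<inter> C)"
    using assms submodule_subset by (intro set_add_modular) (auto simp: internal_direct_sum_def)
  then show ?thesis
    using H K submodule_subset set_add_zero unfolding internal_direct_sum_def
    by (metis inf.orderE)
qed

text \<open>Regroup M = (H + K) + C as H + (K + C). For the intersection, the modular law gives B
  \<inter> (K + C) = K + (B \<inter> C) = K, and \<open>H\<close> lies in \<open>B\<close> and meets
  \<open>K\<close> trivially.\<close>

lemma internal_direct_sum_restrict_assoc:
  assumes BC: "internal_direct_sum R M B C"
    and HK: "internal_direct_sum R (M\<lparr>carrier := B\<rparr>) H K"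
  shows "internal_direct_sum R M H (K <+>\<^bsub>M\<^esub> C)"
proof -
  have B: "submodule B R M" and C: "submodule C R M" and BC0: "B \<inter> C = {\<zero>\<^bsub>M\<^esub>}"
    and BC1: "B <+>\<^bsub>M\<^esub> C = carrier M"
    using BC unfolding internal_direct_sum_def by auto
  \<comment> \<open>Sums and zero in the restricted module are those of \<open>M\<close>, so the
    decomposition of \<open>B\<close> can be read in \<open>M\<close>.\<close>
  have H: "submodule H R M" "H \<subseteq> B" and K: "submodule K R M" "K \<subseteq> B"
    and HK0: "H \<inter> K = {\<zero>\<^bsub>M\<^esub>}" and HK1: "H <+>\<^bsub>M\<^esub> K = B"
    using HK submodule_restrict_iff[OF B] unfolding internal_direct_sum_def set_add_def' by auto
  note sub = H(1)[THEN submodule_subset] K(1)[THEN submodule_subset] C[THEN submodule_subset]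
  have "H <+>\<^bsub>M\<^esub> (K <+>\<^bsub>M\<^esub> C) = carrier M"
    using set_add_assoc[OF sub] HK1 BC1 by simp
  moreover have "B \<inter> (K <+>\<^bsub>M\<^esub> C) = K"
    using set_add_modular[OF B K(2) sub(3)] BC0 set_add_zero[OF sub(2)] by simp
  then have "H \<inter> (K <+>\<^bsub>M\<^esub> C) = {\<zero>\<^bsub>M\<^esub>}"
    using H(2) HK0 by blast
  ultimately show ?thesis
    using H(1) submodule_set_add[OF K(1) C] unfolding internal_direct_sum_def by simp
qed

text \<open>The projection onto \<open>A\<close> along \<open>C\<close> changes each element only by
  an element of \<open>C\<close>. Since the complement \<open>D\<close> of \<open>H\<close> contains
  \<open>C\<close>, passing from \<open>H\<close> to its image \<open>H'\<close> does not affect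
  being a complement of \<open>D\<close>. The overview's A', B', B'' are \<open>A\<close>,
  \<open>H\<close>, \<open>K\<close> here.\<close>

lemma perspective_transfer_summand:
  assumes "perspective R M B A"
    and "direct_summand R (M\<lparr>carrier := B\<rparr>) H"
  shows "\<exists>H'\<subseteq>A. perspective R M H H'"
proof -
  obtain C where BC: "internal_direct_sum R M B C" and AC: "internal_direct_sum R M A C"
    using assms(1) unfolding perspective_def by blast
  obtain K where HK: "internal_direct_sum R (M\<lparr>carrier := B\<rparr>) H K"
    using assms(2) unfolding direct_summand_def by blast
  define D where "D = K <+>\<^bsub>M\<^esub> C"
  define H' where "H' = A \<inter> (H <+>\<^bsub>M\<^esub> C)"
  have B: "submodule B R M" and C: "submodule C R M" and A: "submodule A R M"
    and AC0: "A \<inter> C = {\<zero>\<^bsub>M\<^esub>}" and AC1: "A <+>\<^bsub>M\<^esub> C = carrier M"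
    using BC AC unfolding internal_direct_sum_def by auto
  have K: "submodule K R M"
    using HK submodule_restrict_iff[OF B] unfolding internal_direct_sum_def by blast
  have HD: "internal_direct_sum R M H D"
    unfolding D_def by (rule internal_direct_sum_restrict_assoc[OF BC HK])
  then have H: "submodule H R M" and D: "submodule D R M" and HD0: "H \<inter> D = {\<zero>\<^bsub>M\<^esub>}"
    and HD1: "H <+>\<^bsub>M\<^esub> D = carrier M"
    unfolding internal_direct_sum_def by auto
  have HC: "submodule (H <+>\<^bsub>M\<^esub> C) R M" and H': "submodule H' R M"
    using H C A submodule_set_add submodule_Int unfolding H'_def by auto
  note sub = H[THEN submodule_subset] K[THEN submodule_subset] C[THEN submodule_subset]
    A[THEN submodule_subset] D[THEN submodule_subset] H'[THEN submodule_subset]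
    HC[THEN submodule_subset]
  have CD: "C \<subseteq> D"
    unfolding D_def using subset_set_add_right[OF K sub(3)] .
  have CHC: "C \<subseteq> H <+>\<^bsub>M\<^esub> C"
    using subset_set_add_right[OF H sub(3)] .
  \<comment> \<open>Modular law inside \<open>D\<close>: D \<inter> (C + H) = C + (D \<inter> H) =
    C. Hence H' \<inter> D falls into A \<inter> C = 0.\<close>
  have "D \<inter> (C <+>\<^bsub>M\<^esub> H) = C"
    using set_add_modular[OF D CD sub(1)] HD0 set_add_zero[OF sub(3)] by (simp add: Int_commute)
  then have "H' \<inter> D = {\<zero>\<^bsub>M\<^esub>}"
    using AC0 set_add_commute[OF sub(1,3)] unfolding H'_def by blast
  moreover have "H' <+>\<^bsub>M\<^esub> D = carrier M"
  proof -
    \<comment> \<open>Modular law inside H + C, which contains \<open>C\<close>. As C + A is all of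
      \<open>M\<close>, the left side is just H + C, so \<open>H\<close> and \<open>H'\<close> agree
      modulo \<open>C\<close>.\<close>
    have "(H <+>\<^bsub>M\<^esub> C) \<inter> (C <+>\<^bsub>M\<^esub> A) = C <+>\<^bsub>M\<^esub> H'"
      using set_add_modular[OF HC CHC sub(4)] unfolding H'_def by (simp add: Int_commute)
    then have eq: "H' <+>\<^bsub>M\<^esub> C = H <+>\<^bsub>M\<^esub> C"
      using AC1 sub set_add_commute by (metis inf.orderE)
    \<comment> \<open>With \<open>C\<close> put first it can be absorbed: H' + D = (H' + C) + K = (H
      + C) + K = H + D.\<close>
    have D': "D = C <+>\<^bsub>M\<^esub> K"
      unfolding D_def using set_add_commute sub by blast
    have "H' <+>\<^bsub>M\<^esub> D = H <+>\<^bsub>M\<^esub> D"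
      using set_add_assoc[OF sub(6,3,2)] set_add_assoc[OF sub(1,3,2)] eq D' by simp
    then show ?thesis using HD1 by simp
  qed
  ultimately have "internal_direct_sum R M H' D"
    using H' D unfolding internal_direct_sum_def by blast
  then show ?thesis
    using HD unfolding perspective_def H'_def by blast
qed

lemma perspective_subset_eq:
  assumes "perspective R M A H" "H \<subseteq> A"
  shows "H = A"
  using assms internal_direct_sum_mono_eq unfolding perspective_def by blast

end

theorem theorem2p1:
  fixes R :: "('r, 'c) ring_scheme" and M :: "('r, 'm, 'd) module_scheme"
  assumes "left_module R M"
    and "perspectivity_transitive R M"
  shows "PSB_property R M"
proof -
  interpret left_module R M by (rule assms(1))
  have "perspective R M A B"
    if B': "direct_summand R (M\<lparr>carrier := B\<rparr>) B'" "perspective R M A B'"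
      and A': "direct_summand R (M\<lparr>carrier := A\<rparr>) A'" "perspective R M B A'"
    for A B A' B'
  proof -
    \<comment> \<open>The transfer runs along the perspectivity of \<open>B\<close> and
      \<open>A'\<close>, carrying the summand \<open>B'\<close> of \<open>B\<close> to
      \<open>A''\<close> inside \<open>A'\<close>.\<close>
    obtain A'' where A'': "A'' \<subseteq> A'" "perspective R M B' A''"
      using perspective_transfer_summand[OF A'(2) B'(1)] by blast
    \<comment> \<open>Transitivity with middle term \<open>B'\<close>. The common complements in the
      two perspectivities show that \<open>A\<close>, \<open>B'\<close> and \<open>A''\<close> are
      direct summands of \<open>M\<close>.\<close>
    have "perspective R M A A''"
      using assms(2) B'(2) A''(2)
      unfolding perspectivity_transitive_def perspective_def direct_summand_def by blast
    \<comment> \<open>\<open>A'\<close> is given as a summand of the restricted module on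
      \<open>A\<close>; once \<open>A\<close> is known to be a submodule of \<open>M\<close>, the
      inclusion of \<open>A'\<close> in \<open>A\<close> can be read off.\<close>
    moreover have "submodule A R M"
      using B'(2) unfolding perspective_def internal_direct_sum_def by blast
    then have "A' \<subseteq> A"
      using A'(1) submodule_restrict_iff unfolding direct_summand_def internal_direct_sum_def by blast
    ultimately have "A' = A"
      using perspective_subset_eq A''(1) by blast
    \<comment> \<open>The perspectivity of \<open>B\<close> and \<open>A'\<close> is now one of
      \<open>B\<close> and \<open>A\<close>, and having a common complement is symmetric.\<close>
    then show ?thesis
      using A'(2) unfolding perspective_def by blast
  qed
  then show ?thesis unfolding PSB_property_def by blast
qed

end
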